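(* Let $\Phi={}^t(\Phi_1,\dots,\Phi_d)$ and $\Omega={}^t(\Omega_1,\dots,\Omega_d)$, with $\Phi_j={}^t(\phi_{j,1},\phi_{j,2})$, $\Omega_j={}^t(\omega_{j,1},\omega_{j,2})\in\mathbb{C}^2$, be unit vectors in $\mathbb{C}^{2d}$, let $(\bm p,\bm q)\in D$, and let $\lambda\in\mathbb{C}\setminus\{a_\Omega(\bm p)\}$. Then the Feshbach map $F(\lambda)$ of the discriminant operator $T$ (see context) can be written as $$F(\lambda)=\Pi^\perp\left(T_0-\lambda-\frac{1}{a_\Omega(\bm p)-\lambda}|\varphi_{\bm q}\rangle\langle\varphi_{\bm q}|\right)\Pi^\perp.$$
   Context: Inner products $\langle\cdot,\cdot\rangle$ are conjugate-linear in the first argument; ${}^*$ on scalars is complex conjugation; $|\varphi\rangle\langle\varphi|$ denotes the operator $f\mapsto\langle\varphi,f\rangle\varphi$. $\sigma_3=\begin{pmatrix}1&0\\0&-1\end{pmatrix}$. $d\ge1$ is an integer; $D=\{(\bm p,\bm q)\in\mathbb{R}^d\times\mathbb{C}^d: p_j^2+|q_j|^2=1,\ j=1,\dots,d\}$. $\{\bm e_j\}_{j=1}^d$ is the standard basis of $\mathbb{Z}^d$; $\mathbbm{1}_A$ is the characteristic function of $A\subset\mathbb{Z}^d$; $\mathcal{H}=\ell^2(\mathbb{Z}^d;\mathbb{C}^{2d})\simeq\bigoplus_{j=1}^d\ell^2(\mathbb{Z}^d;\mathbb{C}^2)$, $\mathcal{K}=\ell^2(\mathbb{Z}^d)$. Shift: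 on $\ell^2(\mathbb{Z}^d;\mathbb{C}^2)$, $$(S_j\psi)(\bm x)=\begin{pmatrix}p_j\psi_1(\bm x)+q_j\psi_2(\bm x+\bm e_j)\\ q_j^*\psi_1(\bm x-\bm e_j)-p_j\psi_2(\bm x)\end{pmatrix},\qquad S=S_1\oplus\cdots\oplus S_d\ \text{ on }\mathcal{H}.$$ Let $\chi(\bm x)=\Phi$ for $\bm x\neq\bm 0$ and $\chi(\bm 0)=\Omega$; define $d_\chi:\mathcal{H}\to\mathcal{K}$ by $(d_\chi\Psi)(\bm x)=\langle\chi(\bm x),\Psi(\bm x)\rangle_{\mathbb{C}^{2d}}$. The discriminant operator is $T=d_\chi Sd_\chi^*$ on $\mathcal{K}$. $a_\Omega(\bm p)=\sum_{j=1}^dp_j\langle\Omega_j,\sigma_3\Omega_j\rangle_{\mathbb{C}^2}$, $a_\Phi(\bm p)=\sum_{j=1}^dp_j\langle\Phi_j,\sigma_3\Phi_j\rangle_{\mathbb{C}^2}$, $\alpha_j=q_j\phi_{j,1}^*\phi_{j,2}$. On $\mathcal{K}$, $(L_jf)(\bm x)=f(\bm x+\bm e_j)$ and $T_0=a_\Phi(\bm p)+\sum_{j=1}^d(\alpha_jL_j+\alpha_j^*L_j^* )$. $\varphi_{\bm q}=\sum_{j=1}^d\bigl(q_j\omega_{j,2}\phi_{j,1}^*\mathbbm{1}_{\{-\bm e_j\}}+q_j^*\omega_{j,1}\phi_{j,2}^*\mathbbm{1}_{\{\bm e_j\}}\bigr)\in\mathcal{K}$. $\Pi=|\mathbbm{1}_{\{\bm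 0\}}\rangle\langle\mathbbm{1}_{\{\bm 0\}}|$, $\Pi^\perp=I_{\mathcal{K}}-\Pi$. Let $(\Pi(T-\lambda)\Pi)_{\mathrm{ran}\,\Pi}$ be the operator on $\mathrm{ran}\,\Pi$ given by $f\mapsto\Pi(T-\lambda)\Pi f$; it is invertible exactly when $\lambda\neq a_\Omega(\bm p)$. For such $\lambda$ the Feshbach map of $T$ is $$F(\lambda)=\Pi^\perp(T-\lambda)\Pi^\perp-\Pi^\perp T\Pi\,(\Pi(T-\lambda)\Pi)_{\mathrm{ran}\,\Pi}^{-1}\,\Pi T\Pi^\perp .$$ *)

theory Defs
  imports "HOL-Analysis.Analysis"
begin

section \<open>Hermitian products on the fibres\<close>

text \<open>Conjugate-linear in the first argument. The class is purely syntactic; it lets one notion of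
  adjoint serve operators between different spaces.\<close>

class cinner =
  fixes cinner :: "'a \<Rightarrow> 'a \<Rightarrow> complex"

instantiation complex :: cinner
begin
definition cinner_complex :: "complex \<Rightarrow> complex \<Rightarrow> complex"
  where "cinner_complex z w = cnj z * w"
instance ..
end

instantiation vec :: (cinner, finite) cinner
begin
definition cinner_vec :: "'a ^ 'b \<Rightarrow> 'a ^ 'b \<Rightarrow> complex"
  where "cinner_vec u v = (\<Sum>i\<in>UNIV. cinner (u $ i) (v $ i))"
instance ..
end

lemma norm_cinner_complex: "norm (cinner z w) \<le> norm z * norm w" for z w :: complex
  by (simp add: cinner_complex_def norm_mult)

lemma norm_cinner_vec:
  fixes u v :: "'a::{cinner,real_normed_vector} ^ 'b::finite"
  assumes "\<And>x y :: 'a. norm (cinner x y) \<le> norm x * norm y"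
  shows "norm (cinner u v) \<le> norm u * norm v"
proof -
  have "norm (cinner u v) \<le> (\<Sum>i\<in>UNIV. \<bar>norm (u $ i)\<bar> * \<bar>norm (v $ i)\<bar>)"
    unfolding cinner_vec_def by (rule sum_norm_le) (simp add: assms)
  also have "\<dots> \<le> L2_set (\<lambda>i. norm (u $ i)) UNIV * L2_set (\<lambda>i. norm (v $ i)) UNIV"
    by (rule L2_set_mult_ineq)
  finally show ?thesis by (simp add: norm_vec_def)
qed

lemma norm_cinner_fibre: "norm (cinner u v) \<le> norm u * norm v" for u v :: "complex^2^'d::finite"
  by (intro norm_cinner_vec norm_cinner_complex)


section \<open>The spaces of square-summable functions\<close>

definition square_summable :: "('i \<Rightarrow> 'v::real_normed_vector) \<Rightarrow> bool"
  where "square_summable f \<longleftrightarrow> (\<lambda>x. (norm (f x))\<^sup>2) summable_on UNIV"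

lemma square_summable_le:
  assumes "square_summable f" and "\<And>x. norm (g x) \<le> C * norm (f x)"
  shows "square_summable g"
  unfolding square_summable_def
proof (rule summable_on_comparison_test)
  show "(\<lambda>x. C\<^sup>2 * (norm (f x))\<^sup>2) summable_on UNIV"
    using assms(1) unfolding square_summable_def by (rule summable_on_cmult_right)
  show "(norm (g x))\<^sup>2 \<le> C\<^sup>2 * (norm (f x))\<^sup>2" for x
    using power_mono[OF assms(2)[of x], of 2] by (simp add: power_mult_distrib)
qed simp

lemma square_summable_add:
  assumes "square_summable f" and "square_summable g"
  shows "square_summable (\<lambda>x. f x + g x)"
  unfolding square_summable_def
proof (rule summable_on_comparison_test)
  show "(\<lambda>x. 2 * (norm (f x))\<^sup>2 + 2 * (norm (g x))\<^sup>2) summable_on UNIV"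
    using assms unfolding square_summable_def
    by (intro summable_on_add summable_on_cmult_right)
  show "(norm (f x + g x))\<^sup>2 \<le> 2 * (norm (f x))\<^sup>2 + 2 * (norm (g x))\<^sup>2" for x
  proof -
    have "(norm (f x + g x))\<^sup>2 \<le> (norm (f x) + norm (g x))\<^sup>2"
      by (intro power_mono norm_triangle_ineq) simp
    also have "\<dots> \<le> 2 * (norm (f x))\<^sup>2 + 2 * (norm (g x))\<^sup>2"
      using sum_squares_bound[of "norm (f x)" "norm (g x)"] by (simp add: power2_sum)
    finally show ?thesis .
  qed
qed simp

lemma square_summable_uminus: "square_summable f \<Longrightarrow> square_summable (\<lambda>x. - f x)"
  by (simp add: square_summable_def)

lemma square_summable_diff:
  assumes "square_summable f" and "square_summable g"
  shows "square_summable (\<lambda>x. f x - g x)"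
  using square_summable_add[OF assms(1) square_summable_uminus[OF assms(2)]] by simp

lemma square_summable_mult: "square_summable f \<Longrightarrow> square_summable (\<lambda>x. c * f x)" for c :: complex
  by (rule square_summable_le[where C = "norm c"]) (auto simp: norm_mult)

lemma square_summable_translate:
  fixes f :: "'i::group_add \<Rightarrow> 'v::real_normed_vector"
  assumes "square_summable f"
  shows "square_summable (\<lambda>x. f (x + a))"
proof -
  have "bij_betw (\<lambda>x. x + a) UNIV UNIV"
    by (rule bij_betw_byWitness[where f' = "\<lambda>x. x - a"]) auto
  from summable_on_reindex_bij_betw[OF this, of "\<lambda>x. (norm (f x))\<^sup>2"]
  show ?thesis using assms by (simp add: square_summable_def)
qed

lemma square_summable_vec_iff:
  fixes f :: "'i \<Rightarrow> 'v::real_normed_vector ^ 'n::finite"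
  shows "square_summable f \<longleftrightarrow> (\<forall>j. square_summable (\<lambda>x. f x $ j))"
proof
  assume "square_summable f"
  then show "\<forall>j. square_summable (\<lambda>x. f x $ j)"
    by (auto intro: square_summable_le[where C = 1 and f = f] simp: Finite_Cartesian_Product.norm_nth_le)
next
  assume "\<forall>j. square_summable (\<lambda>x. f x $ j)"
  then have "(\<lambda>x. \<Sum>j\<in>UNIV. (norm (f x $ j))\<^sup>2) summable_on UNIV"
    unfolding square_summable_def by (induction rule: finite_induct[OF finite[of UNIV]])
      (auto intro: summable_on_add)
  then show "square_summable f"
    by (simp add: square_summable_def norm_vec_def L2_set_def sum_nonneg)
qed

typedef (overloaded) ('i, 'v::real_normed_vector) ell2 = "{f :: 'i \<Rightarrow> 'v. square_summable f}"
  morphisms ell2_apply Abs_ell2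
  by (rule exI[of _ "\<lambda>_. 0"]) (simp add: square_summable_def)

setup_lifting type_definition_ell2

instantiation ell2 :: (type, real_normed_vector) ab_group_add
begin
lift_definition zero_ell2 :: "('a, 'b) ell2" is "\<lambda>_. 0"
  by (simp add: square_summable_def)
lift_definition plus_ell2 :: "('a, 'b) ell2 \<Rightarrow> ('a, 'b) ell2 \<Rightarrow> ('a, 'b) ell2"
  is "\<lambda>f g x. f x + g x" by (rule square_summable_add)
lift_definition minus_ell2 :: "('a, 'b) ell2 \<Rightarrow> ('a, 'b) ell2 \<Rightarrow> ('a, 'b) ell2"
  is "\<lambda>f g x. f x - g x" by (rule square_summable_diff)
lift_definition uminus_ell2 :: "('a, 'b) ell2 \<Rightarrow> ('a, 'b) ell2"
  is "\<lambda>f x. - f x" by (rule square_summable_uminus)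
instance by standard (transfer; simp add: algebra_simps)+
end

instantiation ell2 :: (type, "{real_normed_vector, cinner}") cinner
begin
definition cinner_ell2 :: "('a, 'b) ell2 \<Rightarrow> ('a, 'b) ell2 \<Rightarrow> complex"
  where "cinner_ell2 f g = (\<Sum>\<^sub>\<infinity>x. cinner (ell2_apply f x) (ell2_apply g x))"
instance ..
end

lift_definition scaleC :: "complex \<Rightarrow> ('i, complex) ell2 \<Rightarrow> ('i, complex) ell2"  (infixr "*\<^sub>C" 75)
  is "\<lambda>c f x. c * f x" by (rule square_summable_mult)

text \<open>The characteristic function of the singleton \<open>{a}\<close>.\<close>

lift_definition delta :: "'i \<Rightarrow> ('i, complex) ell2" is "\<lambda>a. indicator {a}"
  unfolding square_summable_def
  by (rule finite_nonzero_values_imp_summable_on) (auto simp: indicator_def)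

text \<open>The operator \<open>|\<phi>\<rangle>\<langle>\<phi>|\<close>.\<close>

definition ket_bra :: "('i, complex) ell2 \<Rightarrow> ('i, complex) ell2 \<Rightarrow> ('i, complex) ell2"
  where "ket_bra \<phi> f = cinner \<phi> f *\<^sub>C \<phi>"

text \<open>Same pattern as \<^const>\<open>adjoint\<close>, but for the Hermitian product. The lemmas below show that
  for the operators of this theory the choice is determined.\<close>

definition cadjoint :: "('a::cinner \<Rightarrow> 'b::cinner) \<Rightarrow> 'b \<Rightarrow> 'a"
  where "cadjoint A = (SOME B. \<forall>f g. cinner (A f) g = cinner f (B g))"

lemma cadjoint_eqI:
  fixes A :: "'a::cinner \<Rightarrow> 'b::cinner"
  assumes "\<And>f g. cinner (A f) g = cinner f (B g)"
    and "\<And>h h' :: 'a. (\<And>f. cinner f h = cinner f h') \<Longrightarrow> h = h'"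
  shows "cadjoint A = B"
  unfolding cadjoint_def
  by (rule some_equality) (use assms in \<open>force intro!: ext\<close>)+

lemma cinner_fibre_nondegenerate:
  fixes u v :: "complex ^ 2 ^ 'd::finite"
  assumes "\<And>w. cinner w u = cinner w v"
  shows "u = v"
proof -
  have *: "cinner (axis j (axis k 1)) w = w $ j $ k" for w :: "complex ^ 2 ^ 'd" and j k
  proof -
    have "cinner (axis j (axis k 1)) w
        = (\<Sum>i\<in>UNIV. \<Sum>l\<in>UNIV. if i = j \<and> l = k then w $ j $ k else 0)"
      unfolding cinner_vec_def cinner_complex_def
      by (intro sum.cong refl) (auto simp: axis_def)
    also have "\<dots> = (\<Sum>i\<in>UNIV. if i = j then w $ j $ k else 0)"
      by (intro sum.cong refl) auto
    finally show ?thesis by simp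
  qed
  show ?thesis
    using assms[of "axis _ (axis _ 1)"] by (simp add: * vec_eq_iff)
qed

lemma cinner_zero_left_complex: "cinner 0 z = 0" for z :: complex
  by (simp add: cinner_complex_def)

lemma cinner_zero_left_fibre: "cinner 0 v = 0" for v :: "complex ^ 2 ^ 'd::finite"
  by (simp add: cinner_vec_def cinner_complex_def)

lemma cinner_ell2_nondegenerate:
  fixes h h' :: "('i, 'v::{real_normed_vector, cinner}) ell2"
  assumes "\<And>f. cinner f h = cinner f h'"
    and zero: "\<And>v :: 'v. cinner 0 v = 0"
    and nondeg: "\<And>u v :: 'v. (\<And>w. cinner w u = cinner w v) \<Longrightarrow> u = v"
  shows "h = h'"
proof -
  have "ell2_apply h a = ell2_apply h' a" for a
  proof (rule nondeg)
    fix w :: 'v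
    define d where "d = Abs_ell2 (\<lambda>x. if x = a then w else 0)"
    have "square_summable (\<lambda>x. if x = a then w else 0)"
      unfolding square_summable_def
      by (rule finite_nonzero_values_imp_summable_on) (auto split: if_splits)
    then have d: "ell2_apply d = (\<lambda>x. if x = a then w else 0)"
      by (simp add: d_def Abs_ell2_inverse)
    have "cinner d k = cinner w (ell2_apply k a)" for k
    proof -
      have "cinner d k = (\<Sum>\<^sub>\<infinity>x\<in>{a}. cinner (ell2_apply d x) (ell2_apply k x))"
        unfolding cinner_ell2_def by (rule infsum_cong_neutral) (auto simp: d zero)
      then show ?thesis by (simp add: d)
    qed
    then show "cinner w (ell2_apply h a) = cinner w (ell2_apply h' a)"
      using assms(1)[of d] by simp
  qed
  then show ?thesis by (simp add: ell2_apply_inject[symmetric] ext)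
qed

lemma cadjoint_walk_eqI:
  fixes A :: "('i, complex ^ 2 ^ 'd::finite) ell2 \<Rightarrow> 'b::cinner"
  assumes "\<And>f g. cinner (A f) g = cinner f (B g)"
  shows "cadjoint A = B"
  by (rule cadjoint_eqI[OF assms])
    (rule cinner_ell2_nondegenerate[OF _ cinner_zero_left_fibre cinner_fibre_nondegenerate])

lemma cadjoint_lattice_eqI:
  fixes A :: "('i, complex) ell2 \<Rightarrow> 'b::cinner"
  assumes "\<And>f g. cinner (A f) g = cinner f (B g)"
  shows "cadjoint A = B"
proof (rule cadjoint_eqI[OF assms])
  fix h h' :: "('i, complex) ell2"
  assume *: "\<And>f. cinner f h = cinner f h'"
  show "h = h'"
  proof (rule cinner_ell2_nondegenerate[OF * cinner_zero_left_complex])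
    fix u v :: complex
    assume "\<And>w. cinner w u = cinner w v"
    from this[of 1] show "u = v" by (simp add: cinner_complex_def)
  qed
qed


section \<open>The Feshbach map\<close>

text \<open>The projection \<open>P\<close> is kept general. The inverse is that of the compression
  \<open>P (T - z) P\<close> as a map on the range of \<open>P\<close>.\<close>

definition feshbach ::
  "(('i, complex) ell2 \<Rightarrow> ('i, complex) ell2) \<Rightarrow> (('i, complex) ell2 \<Rightarrow> ('i, complex) ell2)
    \<Rightarrow> complex \<Rightarrow> ('i, complex) ell2 \<Rightarrow> ('i, complex) ell2"
  where "feshbach P T z f =
    (let P' = (\<lambda>f. f - P f);
         T' = (\<lambda>f. T f - z *\<^sub>C f);
         R = inv_into (range P) (\<lambda>f. P (T' (P f)))
     in P' (T' (P' f)) - P' (T (P (R (P (T (P' f)))))))"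


section \<open>The walk\<close>

text \<open>The position space is \<open>\<int>\<^sup>d = int ^ 'd\<close> and the fibre
  \<open>\<complex>\<^sup>2\<^sup>d = \<complex>\<^sup>2 \<oplus> \<dots> \<oplus> \<complex>\<^sup>2\<close> is \<open>complex^2^'d\<close>, so that \<open>\<Phi> $ j $ k\<close> is \<open>\<phi>\<^sub>j\<^sub>,\<^sub>k\<close>.\<close>

type_synonym 'd walk_space = "(int ^ 'd, complex ^ 2 ^ 'd) ell2"
type_synonym 'd lattice_space = "(int ^ 'd, complex) ell2"

definition param_set :: "((real ^ 'd) \<times> (complex ^ 'd)) set"
  where "param_set = {(p, q). \<forall>j. (p $ j)\<^sup>2 + (cmod (q $ j))\<^sup>2 = 1}"

abbreviation unit_vec :: "'d::finite \<Rightarrow> int ^ 'd"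
  where "unit_vec j \<equiv> axis j 1"

lift_definition shift_comp ::
  "real ^ 'd \<Rightarrow> complex ^ 'd \<Rightarrow> 'd::finite \<Rightarrow> (int ^ 'd, complex ^ 2) ell2 \<Rightarrow> (int ^ 'd, complex ^ 2) ell2"
  is "\<lambda>p q j \<psi> x. vector [complex_of_real (p $ j) * \<psi> x $ 1 + q $ j * \<psi> (x + unit_vec j) $ 2,
                        cnj (q $ j) * \<psi> (x - unit_vec j) $ 1 - complex_of_real (p $ j) * \<psi> x $ 2]"
proof -
  fix p :: "real ^ 'd" and q :: "complex ^ 'd" and j :: 'd and \<psi> :: "int ^ 'd \<Rightarrow> complex ^ 2"
  assume "square_summable \<psi>"
  then have *: "square_summable (\<lambda>x. \<psi> x $ k)" for k
    by (simp add: square_summable_vec_iff)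
  have **: "square_summable (\<lambda>x. \<psi> (x + a) $ k)" for k a
    by (rule square_summable_translate[OF *])
  show "square_summable (\<lambda>x. vector [complex_of_real (p $ j) * \<psi> x $ 1 + q $ j * \<psi> (x + unit_vec j) $ 2,
      cnj (q $ j) * \<psi> (x - unit_vec j) $ 1 - complex_of_real (p $ j) * \<psi> x $ 2] :: complex ^ 2)"
    unfolding square_summable_vec_iff forall_2
    using **[of "- unit_vec j" 1]
    by (auto intro!: square_summable_add square_summable_diff square_summable_mult * **)
qed

text \<open>The identification of \<open>\<ell>\<^sup>2(\<int>\<^sup>d; \<complex>\<^sup>2\<^sup>d)\<close> with the direct sum of \<open>d\<close> copies of
  \<open>\<ell>\<^sup>2(\<int>\<^sup>d; \<complex>\<^sup>2)\<close>: \<open>component j\<close> is the projection to the \<open>j\<close>-th summand.\<close>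

lift_definition component :: "'d \<Rightarrow> 'd::finite walk_space \<Rightarrow> (int ^ 'd, complex ^ 2) ell2"
  is "\<lambda>j \<Psi> x. \<Psi> x $ j"
  by (simp add: square_summable_vec_iff[where 'n = 'd])

lift_definition direct_sum :: "('d \<Rightarrow> (int ^ 'd, complex ^ 2) ell2) \<Rightarrow> 'd::finite walk_space"
  is "\<lambda>\<psi> x. \<chi> j. \<psi> j x"
  by (simp add: square_summable_vec_iff[where 'n = 'd])

definition shift :: "real ^ 'd \<Rightarrow> complex ^ 'd \<Rightarrow> 'd::finite walk_space \<Rightarrow> 'd walk_space"
  where "shift p q \<Psi> = direct_sum (\<lambda>j. shift_comp p q j (component j \<Psi>))"

definition coin_vec :: "complex ^ 2 ^ 'd \<Rightarrow> complex ^ 2 ^ 'd \<Rightarrow> int ^ 'd \<Rightarrow> complex ^ 2 ^ 'd"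
  where "coin_vec \<Phi> \<Omega> x = (if x = 0 then \<Omega> else \<Phi>)"

lift_definition d_chi ::
  "complex ^ 2 ^ 'd \<Rightarrow> complex ^ 2 ^ 'd \<Rightarrow> 'd::finite walk_space \<Rightarrow> 'd lattice_space"
  is "\<lambda>\<Phi> \<Omega> \<Psi> x. cinner (coin_vec \<Phi> \<Omega> x) (\<Psi> x)"
proof -
  fix \<Phi> \<Omega> :: "complex ^ 2 ^ 'd" and \<Psi> :: "int ^ 'd \<Rightarrow> complex ^ 2 ^ 'd"
  assume "square_summable \<Psi>"
  then show "square_summable (\<lambda>x. cinner (coin_vec \<Phi> \<Omega> x) (\<Psi> x))"
  proof (rule square_summable_le)
    show "norm (cinner (coin_vec \<Phi> \<Omega> x) (\<Psi> x)) \<le> (norm \<Phi> + norm \<Omega>) * norm (\<Psi> x)" for x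
      by (rule order.trans[OF norm_cinner_fibre]) (auto simp: coin_vec_def intro!: mult_right_mono)
  qed
qed

lift_definition d_chi_adj ::
  "complex ^ 2 ^ 'd \<Rightarrow> complex ^ 2 ^ 'd \<Rightarrow> 'd::finite lattice_space \<Rightarrow> 'd walk_space"
  is "\<lambda>\<Phi> \<Omega> f x. \<chi> j. \<chi> k. f x * coin_vec \<Phi> \<Omega> x $ j $ k"
proof -
  fix \<Phi> \<Omega> :: "complex ^ 2 ^ 'd" and f :: "int ^ 'd \<Rightarrow> complex"
  assume f: "square_summable f"
  have "square_summable (\<lambda>x. f x * coin_vec \<Phi> \<Omega> x $ j $ k)" for j k
    by (rule square_summable_le[OF f, where C = "norm (\<Phi> $ j $ k) + norm (\<Omega> $ j $ k)"])
      (auto simp: coin_vec_def norm_mult algebra_simps)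
  then show "square_summable (\<lambda>x. (\<chi> j. \<chi> k. f x * coin_vec \<Phi> \<Omega> x $ j $ k) :: complex ^ 2 ^ 'd)"
    by (simp add: square_summable_vec_iff[where 'n = 'd] square_summable_vec_iff[where 'n = 2])
qed

lemma cadjoint_d_chi: "cadjoint (d_chi \<Phi> \<Omega>) = d_chi_adj \<Phi> \<Omega>"
proof (rule cadjoint_walk_eqI)
  fix f g
  have "cinner (ell2_apply (d_chi \<Phi> \<Omega> f) x) (ell2_apply g x)
      = cinner (ell2_apply f x) (ell2_apply (d_chi_adj \<Phi> \<Omega> g) x)" for x
    by (simp add: d_chi.rep_eq d_chi_adj.rep_eq cinner_vec_def cinner_complex_def
        sum_distrib_left sum_distrib_right mult_ac)
  then show "cinner (d_chi \<Phi> \<Omega> f) g = cinner f (d_chi_adj \<Phi> \<Omega> g)"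
    by (simp add: cinner_ell2_def)
qed

definition discriminant ::
  "complex ^ 2 ^ 'd \<Rightarrow> complex ^ 2 ^ 'd \<Rightarrow> real ^ 'd \<Rightarrow> complex ^ 'd \<Rightarrow> 'd::finite lattice_space \<Rightarrow> 'd lattice_space"
  where "discriminant \<Phi> \<Omega> p q = d_chi \<Phi> \<Omega> \<circ> shift p q \<circ> cadjoint (d_chi \<Phi> \<Omega>)"

definition sigma3 :: "complex ^ 2 ^ 2"
  where "sigma3 = vector [vector [1, 0], vector [0, - 1]]"

definition a_coef :: "complex ^ 2 ^ 'd \<Rightarrow> real ^ 'd \<Rightarrow> complex"
  where "a_coef \<Xi> p = (\<Sum>j\<in>UNIV. complex_of_real (p $ j) * cinner (\<Xi> $ j) (sigma3 *v (\<Xi> $ j)))"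

definition alpha_coef :: "complex ^ 2 ^ 'd \<Rightarrow> complex ^ 'd \<Rightarrow> 'd \<Rightarrow> complex"
  where "alpha_coef \<Phi> q j = q $ j * cnj (\<Phi> $ j $ 1) * \<Phi> $ j $ 2"

lift_definition translation :: "'d \<Rightarrow> 'd::finite lattice_space \<Rightarrow> 'd lattice_space"
  is "\<lambda>j f x. f (x + unit_vec j)"
  by (rule square_summable_translate)

lift_definition translation_back :: "'d \<Rightarrow> 'd::finite lattice_space \<Rightarrow> 'd lattice_space"
  is "\<lambda>j f x. f (x - unit_vec j)"
  using square_summable_translate[of _ "- unit_vec _"] by simp

lemma cadjoint_translation: "cadjoint (translation j) = translation_back j"
proof (rule cadjoint_lattice_eqI)
  fix f g
  have "bij_betw (\<lambda>x. x + unit_vec j) UNIV UNIV"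
    by (rule bij_betw_byWitness[where f' = "\<lambda>x. x - unit_vec j"]) auto
  from infsum_reindex_bij_betw[OF this,
      of "\<lambda>x. cinner (ell2_apply f x) (ell2_apply g (x - unit_vec j))"]
  show "cinner (translation j f) g = cinner f (translation_back j g)"
    by (simp add: cinner_ell2_def translation.rep_eq translation_back.rep_eq)
qed

definition T0 :: "complex ^ 2 ^ 'd \<Rightarrow> real ^ 'd \<Rightarrow> complex ^ 'd \<Rightarrow> 'd::finite lattice_space \<Rightarrow> 'd lattice_space"
  where "T0 \<Phi> p q f = a_coef \<Phi> p *\<^sub>C f +
    (\<Sum>j\<in>UNIV. alpha_coef \<Phi> q j *\<^sub>C translation j f
               + cnj (alpha_coef \<Phi> q j) *\<^sub>C cadjoint (translation j) f)"

definition phi_q :: "complex ^ 2 ^ 'd \<Rightarrow> complex ^ 2 ^ 'd \<Rightarrow> complex ^ 'd \<Rightarrow> 'd::finite lattice_space"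
  where "phi_q \<Phi> \<Omega> q =
    (\<Sum>j\<in>UNIV. (q $ j * \<Omega> $ j $ 2 * cnj (\<Phi> $ j $ 1)) *\<^sub>C delta (- unit_vec j)
               + (cnj (q $ j) * \<Omega> $ j $ 1 * cnj (\<Phi> $ j $ 2)) *\<^sub>C delta (unit_vec j))"

definition Pi_proj :: "'d::finite lattice_space \<Rightarrow> 'd lattice_space"
  where "Pi_proj = ket_bra (delta 0)"

definition Pi_perp :: "'d::finite lattice_space \<Rightarrow> 'd lattice_space"
  where "Pi_perp f = f - Pi_proj f"

end

theory Submission
  imports Defs
begin

text \<open>Since the defect of the coin sits at the single site \<open>0\<close>, a function \<open>g\<close> with \<open>g 0 = 0\<close> only
  sees the coin \<open>\<Phi>\<close>, so \<open>T g\<close> agrees with \<open>T\<^sub>0 g\<close> away from \<open>0\<close>, and \<open>\<Omega>\<close> enters only through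
  \<open>(T g) 0 = \<langle>\<phi>\<^sub>q, g\<rangle>\<close>. Conversely, \<open>T\<close> maps the delta function at \<open>0\<close> to \<open>\<phi>\<^sub>q\<close> away from \<open>0\<close>, with value
  \<open>a\<^sub>\<Omega>\<close> at \<open>0\<close>. Hence the compression of \<open>T - \<lambda>\<close> to the range of \<open>\<Pi>\<close> is multiplication by
  \<open>a\<^sub>\<Omega> - \<lambda>\<close>, and the second term of the Feshbach map has rank one.\<close>

lemma ell2_eqI: "(\<And>x. ell2_apply f x = ell2_apply g x) \<Longrightarrow> f = g"
  by (simp add: ell2_apply_inject[symmetric] ext)

lemma ell2_apply_sum: "ell2_apply (\<Sum>i\<in>I. f i) x = (\<Sum>i\<in>I. ell2_apply (f i) x)"
  by (induction I rule: infinite_finite_induct) (simp_all add: zero_ell2.rep_eq plus_ell2.rep_eq)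

lemmas ell2_apply_simps =
  ell2_apply_sum plus_ell2.rep_eq minus_ell2.rep_eq scaleC.rep_eq delta.rep_eq

lemma has_sum_sum:
  fixes f :: "'i \<Rightarrow> 'a \<Rightarrow> 'b::topological_comm_monoid_add"
  assumes "\<And>i. i \<in> I \<Longrightarrow> (f i has_sum s i) A"
  shows "((\<lambda>x. \<Sum>i\<in>I. f i x) has_sum (\<Sum>i\<in>I. s i)) A"
  using assms by (induction I rule: infinite_finite_induct) (simp_all add: has_sum_add)

text \<open>Phrased with \<open>has_sum\<close> rather than \<open>infsum\<close>, so that the point
  masses making up \<open>phi_q\<close> can be added up with summability carried along.\<close>

lemma has_sum_cinner_delta:
  "((\<lambda>x. cinner (c * ell2_apply (delta a) x) (ell2_apply g x)) has_sum cnj c * ell2_apply g a) UNIV"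
  by (rule has_sum_finite_neutralI[where B = "{a}"]) (auto simp: cinner_complex_def delta.rep_eq)

lemma cinner_delta: "cinner (delta a) g = ell2_apply g a"
  using infsumI[OF has_sum_cinner_delta[of 1 a g]] by (simp add: cinner_ell2_def)

lemma cinner_phi_q:
  "cinner (phi_q \<Phi> \<Omega> q) g =
    (\<Sum>j\<in>UNIV. cnj (q $ j * \<Omega> $ j $ 2) * \<Phi> $ j $ 1 * ell2_apply g (- unit_vec j)
             + q $ j * cnj (\<Omega> $ j $ 1) * \<Phi> $ j $ 2 * ell2_apply g (unit_vec j))"
proof -
  have "((\<lambda>x. \<Sum>j\<in>UNIV.
        cinner ((q $ j * \<Omega> $ j $ 2 * cnj (\<Phi> $ j $ 1)) * ell2_apply (delta (- unit_vec j)) x) (ell2_apply g x)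
      + cinner ((cnj (q $ j) * \<Omega> $ j $ 1 * cnj (\<Phi> $ j $ 2)) * ell2_apply (delta (unit_vec j)) x) (ell2_apply g x))
    has_sum (\<Sum>j\<in>UNIV.
        cnj (q $ j * \<Omega> $ j $ 2 * cnj (\<Phi> $ j $ 1)) * ell2_apply g (- unit_vec j)
      + cnj (cnj (q $ j) * \<Omega> $ j $ 1 * cnj (\<Phi> $ j $ 2)) * ell2_apply g (unit_vec j))) UNIV"
    by (intro has_sum_sum has_sum_add has_sum_cinner_delta)
  from infsumI[OF this] show ?thesis
    by (simp add: cinner_ell2_def phi_q_def ell2_apply_simps cinner_complex_def
        sum_distrib_right distrib_right)
qed

lemma Pi_proj_eq: "Pi_proj f = ell2_apply f 0 *\<^sub>C delta 0"
  by (simp add: Pi_proj_def ket_bra_def cinner_delta)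

lemma Pi_perp_apply: "ell2_apply (Pi_perp f) x = (if x = 0 then 0 else ell2_apply f x)"
  by (simp add: Pi_perp_def Pi_proj_eq ell2_apply_simps)

text \<open>The coins at \<open>x\<close> and at its two neighbours in each direction stay
  unevaluated here; the cases below differ only in which of these sites is the origin.\<close>

lemma discriminant_apply:
  "ell2_apply (discriminant \<Phi> \<Omega> p q f) x =
    (\<Sum>j\<in>UNIV. cnj (coin_vec \<Phi> \<Omega> x $ j $ 1) *
        (p $ j * ell2_apply f x * coin_vec \<Phi> \<Omega> x $ j $ 1
         + q $ j * ell2_apply f (x + unit_vec j) * coin_vec \<Phi> \<Omega> (x + unit_vec j) $ j $ 2)
      + cnj (coin_vec \<Phi> \<Omega> x $ j $ 2) *
        (cnj (q $ j) * ell2_apply f (x - unit_vec j) * coin_vec \<Phi> \<Omega> (x - unit_vec j) $ j $ 1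
         - p $ j * ell2_apply f x * coin_vec \<Phi> \<Omega> x $ j $ 2))"
  by (simp add: discriminant_def cadjoint_d_chi d_chi.rep_eq shift_def direct_sum.rep_eq
      shift_comp.rep_eq component.rep_eq d_chi_adj.rep_eq cinner_vec_def cinner_complex_def sum_2 mult.assoc)

lemma a_coef_eq:
  "a_coef \<Xi> p = (\<Sum>j\<in>UNIV. p $ j * (cnj (\<Xi> $ j $ 1) * \<Xi> $ j $ 1 - cnj (\<Xi> $ j $ 2) * \<Xi> $ j $ 2))"
  by (simp add: a_coef_def cinner_vec_def cinner_complex_def sum_2 sigma3_def matrix_vector_mult_def)

lemma unit_vec_nonzero: "unit_vec j \<noteq> (0 :: int ^ 'd::finite)"
  by (simp add: axis_eq_0_iff)

lemma discriminant_apply_nonzero: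
  assumes "ell2_apply g 0 = 0" and "x \<noteq> 0"
  shows "ell2_apply (discriminant \<Phi> \<Omega> p q g) x = ell2_apply (T0 \<Phi> p q g) x"
proof -
  \<comment> \<open>The coin differs from \<open>\<Phi>\<close> only at the origin, and there the
    factor \<open>g 0 = 0\<close> hides the difference.\<close>
  have *: "ell2_apply g y * coin_vec \<Phi> \<Omega> y $ j $ k = ell2_apply g y * \<Phi> $ j $ k" for y j k
    using assms(1) by (simp add: coin_vec_def)
  have "coin_vec \<Phi> \<Omega> x = \<Phi>"
    using assms(2) by (simp add: coin_vec_def)
  then show ?thesis
    by (simp add: discriminant_apply T0_def ell2_apply_simps cadjoint_translation translation.rep_eq
        translation_back.rep_eq alpha_coef_def a_coef_eq mult.assoc * sum_distrib_right
        flip: sum.distrib)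
      (simp add: algebra_simps)
qed

text \<open>At the origin the diagonal terms vanish with \<open>g 0\<close>. The hopping terms pair
  the outer coin \<open>\<Omega>\<close> with the coin \<open>\<Phi>\<close> of the neighbours,
  which gives the conjugated coefficients of \<open>phi_q\<close>.\<close>

lemma discriminant_apply_zero:
  assumes "ell2_apply g 0 = 0"
  shows "ell2_apply (discriminant \<Phi> \<Omega> p q g) 0 = cinner (phi_q \<Phi> \<Omega> q) g"
  using assms
  by (simp add: discriminant_apply cinner_phi_q coin_vec_def unit_vec_nonzero algebra_simps)

lemma discriminant_delta_apply:
  "ell2_apply (discriminant \<Phi> \<Omega> p q (c *\<^sub>C delta 0)) x =
    c * (if x = 0 then a_coef \<Omega> p else ell2_apply (phi_q \<Phi> \<Omega> q) x)"
proof (cases "x = 0")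
  case True
  then show ?thesis
    by (simp add: discriminant_apply ell2_apply_simps coin_vec_def unit_vec_nonzero a_coef_eq
        sum_distrib_left algebra_simps)
next
  case False
  \<comment> \<open>Away from the origin only the hops that land on it contribute, so these
    equivalences produce exactly the two point masses per direction in \<open>phi_q\<close>.\<close>
  have *: "x + unit_vec j = 0 \<longleftrightarrow> x = - unit_vec j" "x - unit_vec j = 0 \<longleftrightarrow> x = unit_vec j" for j
    by (auto simp: eq_neg_iff_add_eq_0)
  show ?thesis
    using False
    by (auto simp: discriminant_apply phi_q_def ell2_apply_simps coin_vec_def * sum_distrib_left
        indicator_def algebra_simps intro!: sum.cong)
qed

lemma inv_into_compression:
  fixes \<Phi> \<Omega> :: "complex ^ 2 ^ 'd::finite"
  assumes "lam \<noteq> a_coef \<Omega> p"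
  shows "inv_into (range Pi_proj)
      (\<lambda>f. Pi_proj (discriminant \<Phi> \<Omega> p q (Pi_proj f) - lam *\<^sub>C Pi_proj f)) (c *\<^sub>C delta 0)
    = (c / (a_coef \<Omega> p - lam)) *\<^sub>C delta 0" (is "inv_into _ ?A _ = _")
proof (rule inv_into_f_eq)
  \<comment> \<open>The compression sees only the value at the origin. It is therefore injective
    only after restriction to the range of \<open>Pi_proj\<close>, whose elements are determined by
    that value.\<close>
  have A: "?A f = ((a_coef \<Omega> p - lam) * ell2_apply f 0) *\<^sub>C delta 0" for f
    by (simp add: Pi_proj_eq discriminant_delta_apply ell2_apply_simps algebra_simps)
  have scaled_delta_eq: "b *\<^sub>C delta 0 = c *\<^sub>C delta (0 :: int ^ 'd) \<Longrightarrow> b = c" for b c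
    by (drule arg_cong[where f = "\<lambda>f. ell2_apply f 0"]) (simp add: ell2_apply_simps)
  show "inj_on ?A (range Pi_proj)"
  proof (rule inj_onI)
    fix f g :: "'d lattice_space"
    assume f: "f \<in> range Pi_proj" and g: "g \<in> range Pi_proj" and "?A f = ?A g"
    then have "ell2_apply f 0 = ell2_apply g 0"
      using assms scaled_delta_eq unfolding A by force
    moreover have "f = ell2_apply f 0 *\<^sub>C delta 0" "g = ell2_apply g 0 *\<^sub>C delta 0"
      using f g by (auto simp: Pi_proj_eq ell2_apply_simps)
    ultimately show "f = g" by simp
  qed
  show "(c / (a_coef \<Omega> p - lam)) *\<^sub>C delta 0 \<in> range Pi_proj"
    by (rule range_eqI[of _ _ "(c / (a_coef \<Omega> p - lam)) *\<^sub>C delta 0"])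
      (simp add: Pi_proj_eq ell2_apply_simps)
  show "?A ((c / (a_coef \<Omega> p - lam)) *\<^sub>C delta 0) = c *\<^sub>C delta 0"
    using assms unfolding A by (simp add: ell2_apply_simps)
qed

theorem proposition4p3:
  fixes \<Phi> \<Omega> :: "complex ^ 2 ^ 'd::finite"
    and p :: "real ^ 'd" and q :: "complex ^ 'd" and lam :: complex
  assumes "norm \<Phi> = 1" and "norm \<Omega> = 1"
    and "(p, q) \<in> param_set"
    and "lam \<noteq> a_coef \<Omega> p"
  shows "feshbach Pi_proj (discriminant \<Phi> \<Omega> p q) lam =
    (\<lambda>f. Pi_perp (T0 \<Phi> p q (Pi_perp f) - lam *\<^sub>C Pi_perp f
            - (1 / (a_coef \<Omega> p - lam)) *\<^sub>C ket_bra (phi_q \<Phi> \<Omega> q) (Pi_perp f)))"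
proof
  fix f :: "'d lattice_space"
  let ?T = "discriminant \<Phi> \<Omega> p q"
  define g where "g = Pi_perp f"
  define c where "c = cinner (phi_q \<Phi> \<Omega> q) g"
  have g0: "ell2_apply g 0 = 0"
    by (simp add: g_def Pi_perp_apply)
  have "Pi_proj (?T g) = c *\<^sub>C delta 0"
    by (simp add: Pi_proj_eq discriminant_apply_zero g0 c_def)
  then have "feshbach Pi_proj ?T lam f = Pi_perp (?T g - lam *\<^sub>C g)
      - Pi_perp (?T (Pi_proj ((c / (a_coef \<Omega> p - lam)) *\<^sub>C delta 0)))"
    by (simp add: feshbach_def Let_def inv_into_compression[OF assms(4)] g_def flip: Pi_perp_def)
  also have "Pi_proj ((c / (a_coef \<Omega> p - lam)) *\<^sub>C delta 0)
      = (c / (a_coef \<Omega> p - lam)) *\<^sub>C (delta 0 :: 'd lattice_space)"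
    by (simp add: Pi_proj_eq ell2_apply_simps)
  \<comment> \<open>Compared pointwise: at the origin \<open>Pi_perp\<close> kills both sides;
    elsewhere \<open>?T g\<close> becomes \<open>T0\<close> applied to \<open>g\<close>, and the
    image of the scaled delta is \<open>c / (a_coef \<Omega> p - lam)\<close> times
    \<open>phi_q\<close>, which is the rank-one term because \<open>c\<close> is the inner product
    of \<open>phi_q\<close> with \<open>g\<close>.\<close>
  also have "Pi_perp (?T g - lam *\<^sub>C g) - Pi_perp (?T ((c / (a_coef \<Omega> p - lam)) *\<^sub>C delta 0))
      = Pi_perp (T0 \<Phi> p q g - lam *\<^sub>C g
          - (1 / (a_coef \<Omega> p - lam)) *\<^sub>C ket_bra (phi_q \<Phi> \<Omega> q) g)"
    by (rule ell2_eqI)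
      (simp add: ell2_apply_simps Pi_perp_apply discriminant_apply_nonzero g0
        discriminant_delta_apply ket_bra_def flip: c_def)
  finally show "feshbach Pi_proj ?T lam f =
      Pi_perp (T0 \<Phi> p q (Pi_perp f) - lam *\<^sub>C Pi_perp f
        - (1 / (a_coef \<Omega> p - lam)) *\<^sub>C ket_bra (phi_q \<Phi> \<Omega> q) (Pi_perp f))"
    by (simp add: g_def)
qed

end
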